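(* For a finite tree $T$ on $n = |V(T)|$ vertices with domination number $\gamma(T)$ (and $\gamma(T) < n$), let $$s_6(T) = -\frac{\gamma(T) - 1}{2(n - \gamma(T))} + \frac{\gamma(T)+1}{2} - {}^{m}M_2(T),$$ where ${}^{m}M_2(T) = \sum_{uv \in E(T)} \frac{1}{d_u d_v}$ is the modified second Zagreb index of $T$. For each positive integer $k$, let $T_2(k)$ be the tree on $4k$ vertices with vertex set $\bigcup_{i=1}^k \{u_i, v_i, w_i, x_i\}$ and edge set $\left(\bigcup_{i=1}^k \{u_iv_i, v_iw_i, w_ix_i\}\right) \cup \{w_1w_2, w_2w_3, \dots, w_{k-1}w_k\}$. Then $$\lim_{k \to \infty} s_6(T_2(k)) = \infty.$$
   Context: Graphs are finite, simple and undirected; $V(G)$ and $E(G)$ denote the vertex and edge sets of $G$, an edge $\{u,v\}$ is written $uv$, and $d_v$ denotes the degree of the vertex $v$. A dominating set in $G$ is a set $S \subseteq V(G)$ such that every vertex of $G$ is either an element of $S$ or adjacent to an element of $S$; the domination number $\gamma(G)$ is the minimum possible size of a dominating set in $G$. In the definition of $T_2(k)$ the $4k$ named vertices are pairwise distinct. *)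

theory Defs
  imports Complex_Main
begin

text \<open>
  A finite simple undirected graph is a pair of a vertex set and a set of
  two-element subsets of the vertex set.
\<close>

type_synonym 'a ugraph = "'a set \<times> 'a set set"

abbreviation verts :: "'a ugraph \<Rightarrow> 'a set" where
  "verts G \<equiv> fst G"

abbreviation edges :: "'a ugraph \<Rightarrow> 'a set set" where
  "edges G \<equiv> snd G"

definition simple_graph :: "'a ugraph \<Rightarrow> bool" where
  "simple_graph G \<longleftrightarrow> finite (verts G) \<and> (\<forall>e\<in>edges G. e \<subseteq> verts G \<and> card e = 2)"

definition adjacent :: "'a ugraph \<Rightarrow> 'a \<Rightarrow> 'a \<Rightarrow> bool" where
  "adjacent G u v \<longleftrightarrow> {u, v} \<in> edges G"

definition degree :: "'a ugraph \<Rightarrow> 'a \<Rightarrow> nat" where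
  "degree G v = card {e \<in> edges G. v \<in> e}"

definition connected_graph :: "'a ugraph \<Rightarrow> bool" where
  "connected_graph G \<longleftrightarrow> verts G \<noteq> {} \<and> (\<forall>u\<in>verts G. \<forall>v\<in>verts G. (adjacent G)\<^sup>*\<^sup>* u v)"

definition is_cycle :: "'a ugraph \<Rightarrow> 'a list \<Rightarrow> bool" where
  "is_cycle G p \<longleftrightarrow> 3 \<le> length p \<and> distinct p \<and>
     (\<forall>i<length p. adjacent G (p ! i) (p ! (Suc i mod length p)))"

definition is_tree :: "'a ugraph \<Rightarrow> bool" where
  "is_tree G \<longleftrightarrow> simple_graph G \<and> connected_graph G \<and> (\<nexists>p. is_cycle G p)"

definition dominating_set :: "'a ugraph \<Rightarrow> 'a set \<Rightarrow> bool" where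
  "dominating_set G S \<longleftrightarrow>
     S \<subseteq> verts G \<and> (\<forall>v\<in>verts G. v \<in> S \<or> (\<exists>u\<in>S. adjacent G u v))"

definition domination_number :: "'a ugraph \<Rightarrow> nat" where
  "domination_number G = (LEAST m. \<exists>S. dominating_set G S \<and> card S = m)"

text \<open>For an edge \<open>e = {u, v}\<close> the inner product is \<open>d\<^sub>u d\<^sub>v\<close>.\<close>

definition modified_second_Zagreb :: "'a ugraph \<Rightarrow> real" where
  "modified_second_Zagreb G = (\<Sum>e\<in>edges G. 1 / (\<Prod>v\<in>e. real (degree G v)))"

text \<open>
  Intended for trees whose domination number is smaller than the number of
  vertices; both conditions are established for \<open>T2 k\<close> with \<open>k \<ge> 1\<close> below.
\<close>

definition s6 :: "'a ugraph \<Rightarrow> real" where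
  "s6 T =
     (let n = real (card (verts T)); \<gamma> = real (domination_number T)
      in - ((\<gamma> - 1) / (2 * (n - \<gamma>))) + (\<gamma> + 1) / 2 - modified_second_Zagreb T)"

datatype vertex = U nat | V nat | W nat | X nat

definition T2 :: "nat \<Rightarrow> vertex ugraph" where
  "T2 k =
     ((\<Union>i\<in>{1..k}. {U i, V i, W i, X i}),
      (\<Union>i\<in>{1..k}. {{U i, V i}, {V i, W i}, {W i, X i}}) \<union>
      {{W i, W (i + 1)} | i. 1 \<le> i \<and> i < k})"

lemma card_verts_T2: "card (verts (T2 k)) = 4 * k"
proof -
  have "card (verts (T2 k)) = (\<Sum>i\<in>{1..k}. card {U i, V i, W i, X i})"
    unfolding T2_def fst_conv by (rule card_UN_disjoint) auto
  also have "\<dots> = 4 * k" by simp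
  finally show ?thesis .
qed

lemma simple_graph_T2: "simple_graph (T2 k)"
  unfolding simple_graph_def T2_def by (auto simp: card_insert_if)

lemma adjacent_sym: "adjacent G u v \<longleftrightarrow> adjacent G v u"
  by (simp add: adjacent_def insert_commute)

lemma connected_graph_T2:
  assumes "k \<ge> 1"
  shows "connected_graph (T2 k)"
proof -
  let ?R = "(adjacent (T2 k))\<^sup>*\<^sup>*"
  have sym: "?R u v" if "?R v u" for u v
    using that by (induction rule: rtranclp_induct)
      (blast intro: converse_rtranclp_into_rtranclp adjacent_sym[THEN iffD1])+
  have W: "?R (W 1) (W i)" if "1 \<le> i" "i \<le> k" for i
    using that
  proof (induction i rule: dec_induct)
    case (step i)
    have "adjacent (T2 k) (W i) (W (Suc i))"
      using step by (auto simp: adjacent_def T2_def)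
    with step show ?case by (auto intro: rtranclp.rtrancl_into_rtrancl)
  qed simp
  have root: "?R (W 1) v" if v: "v \<in> verts (T2 k)" for v
  proof -
    obtain i where i: "1 \<le> i" "i \<le> k" "v \<in> {U i, V i, W i, X i}"
      using v by (auto simp: T2_def)
    have "adjacent (T2 k) (W i) (X i)" "adjacent (T2 k) (W i) (V i)"
      "adjacent (T2 k) (V i) (U i)"
      using i by (auto simp: adjacent_def T2_def insert_commute)
    then show ?thesis
      using W[OF i(1,2)] i(3) by (auto intro: rtranclp.rtrancl_into_rtrancl)
  qed
  have "?R u v" if "u \<in> verts (T2 k)" "v \<in> verts (T2 k)" for u v
    using root that sym rtranclp_trans by metis
  moreover have "verts (T2 k) \<noteq> {}" using assms by (auto simp: T2_def)
  ultimately show ?thesis by (auto simp: connected_graph_def)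
qed

text \<open>
  Acyclicity: order the vertices by \<open>rank\<close>; every vertex has at most one
  neighbour of smaller rank, whereas the vertex of largest rank on a cycle
  would have two.
\<close>

fun rank :: "vertex \<Rightarrow> nat" where
  "rank (W i) = 4 * i"
| "rank (V i) = 4 * i + 1"
| "rank (U i) = 4 * i + 2"
| "rank (X i) = 4 * i + 3"

lemma rank_inj: "rank u = rank v \<Longrightarrow> u = v"
  by (cases u; cases v; simp; presburger)

fun parent :: "vertex \<Rightarrow> vertex" where
  "parent (W i) = W (i - 1)"
| "parent (V i) = W i"
| "parent (U i) = V i"
| "parent (X i) = W i"

lemma adjacent_T2_parent:
  assumes "adjacent (T2 k) v u" "rank u < rank v"
  shows "u = parent v"
  using assms by (auto simp: adjacent_def T2_def doubleton_eq_iff)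

lemma acyclic_T2: "\<not> is_cycle (T2 k) p"
proof
  assume c: "is_cycle (T2 k) p"
  define n where "n = length p"
  have n: "n \<ge> 3" and d: "distinct p"
    and adj: "\<And>i. i < n \<Longrightarrow> adjacent (T2 k) (p ! i) (p ! (Suc i mod n))"
    using c by (auto simp: is_cycle_def n_def)
  define M where "M = Max (rank ` set p)"
  have "M \<in> rank ` set p" unfolding M_def using n by (intro Max_in) (auto simp: n_def)
  then obtain m where m: "m < n" "rank (p ! m) = M"
    by (auto simp: in_set_conv_nth n_def)
  have less: "rank (p ! j) < rank (p ! m)" if "j < n" "j \<noteq> m" for j
  proof -
    have "rank (p ! j) \<le> M" unfolding M_def using that by (intro Max_ge) (auto simp: n_def)
    moreover have "rank (p ! j) \<noteq> M"
      using that m d rank_inj by (metis n_def nth_eq_iff_index_eq)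
    ultimately show ?thesis using m by simp
  qed
  define s where "s = (if m = n - 1 then 0 else Suc m)"
  define r where "r = (if m = 0 then n - 1 else m - 1)"
  have s: "s < n" "s \<noteq> m" "Suc m mod n = s" and r: "r < n" "r \<noteq> m" "Suc r mod n = m"
    and "r \<noteq> s"
    using n m by (auto simp: s_def r_def)
  have "p ! s = parent (p ! m)"
    using adj[OF m(1)] s less[of s] by (intro adjacent_T2_parent) auto
  moreover have "p ! r = parent (p ! m)"
    using adj[OF r(1), unfolded r(3), THEN adjacent_sym[THEN iffD1]] less[OF r(1,2)]
    by (rule adjacent_T2_parent)
  ultimately show False
    using d s(1) r(1) \<open>r \<noteq> s\<close> by (metis n_def nth_eq_iff_index_eq)
qed

lemma is_tree_T2: "k \<ge> 1 \<Longrightarrow> is_tree (T2 k)"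
  by (simp add: is_tree_def simple_graph_T2 connected_graph_T2 acyclic_T2)

lemma domination_number_T2_less:
  assumes "k \<ge> 1"
  shows "domination_number (T2 k) < card (verts (T2 k))"
proof -
  let ?S = "verts (T2 k) - {U 1}"
  have "dominating_set (T2 k) ?S"
    using assms unfolding dominating_set_def
    by (auto simp: T2_def adjacent_def insert_commute intro!: bexI[of _ "V 1"])
  then have "domination_number (T2 k) \<le> card ?S"
    unfolding domination_number_def by (intro Least_le) auto
  also have "card ?S < card (verts (T2 k))"
    using assms simple_graph_T2[of k]
    by (intro psubset_card_mono) (auto simp: simple_graph_def T2_def)
  finally show ?thesis .
qed

end

theory Submission
  imports Defs
begin

text \<open>
  Each pair \<open>{U i, V i}\<close> and each pair \<open>{W i, X i}\<close> is the closed neighbourhood of a leaf,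
  so the domination number of \<open>T2 k\<close> is \<open>2 k\<close> and the first two terms of \<open>s6\<close> add up to at least
  \<open>k\<close>. Away from the ends of the path, where \<open>W i\<close> has degree 4, one period of the tree contributes
  \<open>1/2 + 1/8 + 1/4 + 1/16 = 15/16 < 1\<close> to the modified second Zagreb index, which leaves a
  surplus of \<open>k/16\<close> up to a constant.
\<close>

text \<open>The label of a block: \<open>(i, True)\<close> stands for the closed neighbourhood of
  the leaf \<open>U i\<close>, \<open>(i, False)\<close> for that of the leaf \<open>X i\<close>.
  The first component also serves as the index of a vertex.\<close>

fun pair_of :: "vertex \<Rightarrow> nat \<times> bool" where
  "pair_of (U i) = (i, True)"
| "pair_of (V i) = (i, True)"
| "pair_of (W i) = (i, False)"
| "pair_of (X i) = (i, False)"

text \<open>A leaf is dominated only from its own closed neighbourhood, so \<open>pair_of\<close>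
  maps \<open>S\<close> onto all of the 2k labels.\<close>

lemma dominating_set_T2_card_ge:
  assumes "dominating_set (T2 k) S"
  shows "2 * k \<le> card S"
proof -
  have sub: "S \<subseteq> verts (T2 k)"
    and dom: "\<And>v. v \<in> verts (T2 k) \<Longrightarrow> v \<in> S \<or> (\<exists>u\<in>S. adjacent (T2 k) u v)"
    using assms by (auto simp: dominating_set_def)
  have fin: "finite S"
    using sub simple_graph_T2[of k] finite_subset by (auto simp: simple_graph_def)
  have "(i, b) \<in> pair_of ` S" if i: "i \<in> {1..k}" for i b
  proof (cases b)
    case True
    have "U i \<in> S \<or> V i \<in> S"
      using dom[of "U i"] i by (auto simp: T2_def adjacent_def doubleton_eq_iff)
    with True show ?thesis by force
  next
    case False
    have "X i \<in> S \<or> W i \<in> S"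
      using dom[of "X i"] i by (auto simp: T2_def adjacent_def doubleton_eq_iff)
    with False show ?thesis by force
  qed
  then have "{1..k} \<times> UNIV \<subseteq> pair_of ` S" by auto
  then have "card ({1..k} \<times> (UNIV :: bool set)) \<le> card (pair_of ` S)"
    using fin by (intro card_mono) auto
  also have "\<dots> \<le> card S" using fin by (rule card_image_le)
  finally show ?thesis by (simp add: card_cartesian_product)
qed

lemma domination_number_T2: "domination_number (T2 k) = 2 * k"
  unfolding domination_number_def
proof (rule Least_equality)
  \<comment> \<open>The neighbours of the leaves: \<open>V i\<close> dominates \<open>U i\<close>
    and \<open>W i\<close> dominates \<open>X i\<close>.\<close>
  let ?S = "\<Union>i\<in>{1..k}. {V i, W i}"
  have "dominating_set (T2 k) ?S"
    unfolding dominating_set_def by (auto simp: T2_def adjacent_def insert_commute)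
  moreover have "card ?S = (\<Sum>i\<in>{1..k}. card {V i, W i})"
    by (rule card_UN_disjoint) auto
  ultimately show "\<exists>S. dominating_set (T2 k) S \<and> card S = 2 * k"
    by (intro exI[of _ ?S]) auto
qed (use dominating_set_T2_card_ge in blast)

text \<open>Each edge of the path goes to the block of its smaller index, so the blocks partition
  the edge set; the last block has no path edge.\<close>

definition period_edges :: "nat \<Rightarrow> nat \<Rightarrow> vertex set set" where
  "period_edges k i =
     {{U i, V i}, {V i, W i}, {W i, X i}} \<union> (if i < k then {{W i, W (i + 1)}} else {})"

lemma edges_T2: "edges (T2 k) = (\<Union>i\<in>{1..k}. period_edges k i)"
proof -
  have "{f i | i. 1 \<le> i \<and> i < k} = (\<Union>i\<in>{1..k}. if i < k then {f i} else {})"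
    for f :: "nat \<Rightarrow> vertex set"
    by (intro set_eqI) (fastforce split: if_splits)
  then show ?thesis by (simp only: T2_def snd_conv period_edges_def UN_Un_distrib)
qed

lemma finite_edges: "simple_graph G \<Longrightarrow> finite (edges G)"
  unfolding simple_graph_def by (rule finite_subset[of _ "Pow (verts G)"]) auto

text \<open>Listing incident edges bounds a degree from below, which bounds edge weights from
  above.\<close>

lemma degree_ge_card:
  assumes "simple_graph G" "A \<subseteq> edges G" "\<And>e. e \<in> A \<Longrightarrow> v \<in> e"
  shows "card A \<le> degree G v"
  unfolding degree_def
proof (rule card_mono)
  show "finite {e \<in> edges G. v \<in> e}" using finite_edges[OF assms(1)] by simp
qed (use assms in auto)

lemma
  assumes "i \<in> {1..k}"
  shows degree_T2_U: "1 \<le> degree (T2 k) (U i)"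
    and degree_T2_V: "2 \<le> degree (T2 k) (V i)"
    and degree_T2_X: "1 \<le> degree (T2 k) (X i)"
proof -
  have E: "period_edges k i \<subseteq> edges (T2 k)" using assms unfolding edges_T2 by blast
  have "{{U i, V i}} \<subseteq> edges (T2 k)" "{{U i, V i}, {V i, W i}} \<subseteq> edges (T2 k)"
    "{{W i, X i}} \<subseteq> edges (T2 k)"
    using E by (simp_all add: period_edges_def)
  note this[THEN degree_ge_card[OF simple_graph_T2]]
  from this(1)[of "U i"] this(2)[of "V i"] this(3)[of "X i"]
  show "1 \<le> degree (T2 k) (U i)" "2 \<le> degree (T2 k) (V i)" "1 \<le> degree (T2 k) (X i)"
    by (force simp: doubleton_eq_iff)+
qed

lemma degree_T2_W:
  assumes "1 < i" "i < k" shows "4 \<le> degree (T2 k) (W i)"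
proof -
  \<comment> \<open>The path edge to \<open>W (i - 1)\<close> belongs to the preceding block, hence
    the two blocks below.\<close>
  let ?A = "{{V i, W i}, {W i, X i}, {W (i - 1), W i}, {W i, W (i + 1)}}"
  have "period_edges k i \<subseteq> edges (T2 k)" "period_edges k (i - 1) \<subseteq> edges (T2 k)"
    using assms unfolding edges_T2 by (intro UN_upper; simp; linarith)+
  moreover have "?A \<subseteq> period_edges k i \<union> period_edges k (i - 1)"
    using assms by (simp add: period_edges_def less_imp_diff_less)
  ultimately have "?A \<subseteq> edges (T2 k)" by blast
  then have "card ?A \<le> degree (T2 k) (W i)"
    by (rule degree_ge_card[OF simple_graph_T2]) auto
  moreover have "card ?A = 4" using assms by (auto simp: doubleton_eq_iff card_insert_if)
  ultimately show ?thesis by simp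
qed

definition edge_weight :: "'a ugraph \<Rightarrow> 'a set \<Rightarrow> real" where
  "edge_weight G e = 1 / (\<Prod>v\<in>e. real (degree G v))"

text \<open>The denominator is a natural number: it is at least 1, or it is 0 and the quotient is 0
  by convention.\<close>

lemma edge_weight_le_1: "edge_weight G e \<le> 1"
proof -
  have "1 / real n \<le> 1" for n :: nat by (cases n) auto
  from this[of "\<Prod>v\<in>e. degree G v"] show ?thesis by (simp add: edge_weight_def)
qed

lemma edge_weight_le:
  assumes "u \<noteq> v" "a \<le> degree G u" "b \<le> degree G v" "0 < a" "0 < b"
  shows "edge_weight G {u, v} \<le> 1 / (real a * real b)"
proof -
  have "real a * real b \<le> real (degree G u) * real (degree G v)"
    using assms(2,3) by (intro mult_mono) auto
  moreover have "0 < real a * real b" using assms(4,5) by simp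
  ultimately show ?thesis
    using assms(1) by (simp add: edge_weight_def frac_le)
qed

text \<open>An edge determines its block, which makes the blocks pairwise disjoint.\<close>

lemma Min_index_period_edges:
  assumes "e \<in> period_edges k i" shows "Min ((fst \<circ> pair_of) ` e) = i"
  using assms by (auto simp: period_edges_def split: if_splits)

lemma modified_second_Zagreb_T2:
  "modified_second_Zagreb (T2 k) = (\<Sum>i\<in>{1..k}. sum (edge_weight (T2 k)) (period_edges k i))"
  unfolding modified_second_Zagreb_def edges_T2 edge_weight_def[symmetric]
proof (rule sum.UNION_disjoint)
  show "\<forall>i\<in>{1..k}. \<forall>j\<in>{1..k}. i \<noteq> j \<longrightarrow> period_edges k i \<inter> period_edges k j = {}"
    using Min_index_period_edges by (metis disjoint_iff)
qed (auto simp: period_edges_def)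

lemma period_weight_le_4: "sum (edge_weight G) (period_edges k i) \<le> 4"
proof -
  have "sum (edge_weight G) (period_edges k i) \<le> of_nat (card (period_edges k i)) * 1"
    by (rule sum_bounded_above) (rule edge_weight_le_1)
  moreover have "card (period_edges k i) \<le> 4"
    by (auto simp: period_edges_def card_insert_if)
  ultimately show ?thesis by linarith
qed

text \<open>The bound \<open>i + 1 < k\<close> keeps \<open>W (i + 1)\<close> away from the end of
  the path, so it has degree at least 4 as well.\<close>

lemma period_weight_inner:
  assumes "1 < i" "i + 1 < k"
  shows "sum (edge_weight (T2 k)) (period_edges k i) \<le> 15 / 16"
proof -
  let ?w = "edge_weight (T2 k)"
  have i: "i \<in> {1..k}" using assms by auto
  have W: "4 \<le> degree (T2 k) (W i)" "4 \<le> degree (T2 k) (W (i + 1))"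
    using assms by (auto intro!: degree_T2_W)
  have "?w {U i, V i} \<le> 1 / 2"
    using edge_weight_le[OF _ degree_T2_U[OF i] degree_T2_V[OF i]] by simp
  moreover have "?w {V i, W i} \<le> 1 / 8"
    using edge_weight_le[OF _ degree_T2_V[OF i] W(1)] by simp
  moreover have "?w {W i, X i} \<le> 1 / 4"
    using edge_weight_le[OF _ W(1) degree_T2_X[OF i]] by simp
  moreover have "?w {W i, W (i + 1)} \<le> 1 / 16"
    using edge_weight_le[OF _ W] by simp
  moreover have "sum ?w (period_edges k i) =
      ?w {U i, V i} + ?w {V i, W i} + ?w {W i, X i} + ?w {W i, W (i + 1)}"
    using assms by (simp add: period_edges_def doubleton_eq_iff insert_commute)
  ultimately show ?thesis by linarith
qed

lemma modified_second_Zagreb_T2_le: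
  "modified_second_Zagreb (T2 k) \<le> 15 / 16 * real k + 12"
proof -
  \<comment> \<open>The blocks that touch an end of the path. Each is charged 4 extra by the crude
    bound, whence the constant 12; for small k some of these indices coincide or leave the
    range.\<close>
  let ?B = "{1, k - 1, k}"
  have "modified_second_Zagreb (T2 k) \<le> (\<Sum>i\<in>{1..k}. 15 / 16 + (if i \<in> ?B then 4 else 0))"
    unfolding modified_second_Zagreb_T2
  proof (rule sum_mono)
    fix i assume "i \<in> {1..k}"
    then show "sum (edge_weight (T2 k)) (period_edges k i) \<le> 15 / 16 + (if i \<in> ?B then 4 else 0)"
      using period_weight_le_4[of "T2 k" k i] period_weight_inner[of i k] by fastforce
  qed
  also have "\<dots> = 15 / 16 * real k + 4 * real (card ({1..k} \<inter> ?B))"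
    by (simp only: sum.distrib sum.inter_restrict[symmetric] finite_atLeastAtMost) simp
  also have "card ({1..k} \<inter> ?B) \<le> 3"
    by (rule order.trans[OF card_mono[of ?B]]) (auto simp: card_insert_if)
  finally show ?thesis by simp
qed

lemma s6_T2_ge:
  assumes "k \<ge> 1"
  shows "real k / 16 - 12 \<le> s6 (T2 k)"
proof -
  \<comment> \<open>With n = 4k and domination number 2k, \<open>q\<close> is the subtracted
    fraction; its bound 1/2 cancels the 1/2 left over from (2k + 1)/2.\<close>
  define q where "q = (2 * real k - 1) / (4 * real k)"
  have "q \<le> 1 / 2"
    using assms by (simp add: q_def divide_le_eq)
  moreover have "s6 (T2 k) =
      - q + (2 * real k + 1) / 2 - modified_second_Zagreb (T2 k)"
    by (simp add: s6_def q_def Let_def domination_number_T2 card_verts_T2)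
  ultimately show ?thesis
    using modified_second_Zagreb_T2_le[of k] by (simp add: field_simps)
qed

theorem theorem2:
  shows "filterlim (\<lambda>k. s6 (T2 k)) at_top sequentially"
proof (rule filterlim_at_top_mono)
  have "filterlim (\<lambda>k. - 12 + real k * (1 / 16)) at_top sequentially"
    by (intro filterlim_tendsto_add_at_top[OF tendsto_const]
        filterlim_at_top_mult_tendsto_pos[OF tendsto_const] filterlim_real_sequentially) simp
  then show "filterlim (\<lambda>k. real k / 16 - 12) at_top sequentially" by simp
  show "\<forall>\<^sub>F k in sequentially. real k / 16 - 12 \<le> s6 (T2 k)"
    using eventually_ge_at_top[of 1] by eventually_elim (rule s6_T2_ge)
qed

end
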